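(* Let $k\in\{1,\dots,n-1\}$ and let $H$ be an $(n-k)$-dimensional linear subspace of $\mathbb{R}^n$. Let $\phi_k:\mathbb{R}^k\to[0,\infty)$ be quasi-concave, continuous at the origin, with $\|\phi_k\|_\infty=\phi_k(0)$, and let $\phi_{n-k}:\mathbb{R}^{n-k}\to[0,\infty)$ be radially decreasing. Let $\mu_n=\mu_{n-k}\times\mu_k$ be the product measure on $\mathbb{R}^n$, where $d\mu_{n-k}(x)=\phi_{n-k}(x)\,dx$ and $d\mu_k(y)=\phi_k(y)\,dy$. Let $K\subset\mathbb{R}^n$ be a convex body with $P_HK\subset K$ and such that, for every $t\in(0,1)$, the function $x\mapsto\mathrm{vol}_k\bigl(\mathcal{C}_t(\phi_k)\cap K(x)\bigr)$, $x\in P_HK$, attains its maximum at $x=0$. Then $$\mu_{n-k}(P_HK)\,\mu_k(K\cap H^\perp)\le\binom{n}{k}\mu_n(K).$$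
   Context: A convex body is a compact convex set with non-empty interior. $P_H$ is the orthogonal projection onto $H$, $H^\perp$ the orthogonal complement. Orthonormal coordinates are chosen so that $H$ is identified with $\mathbb{R}^{n-k}$ and $H^\perp$ with $\mathbb{R}^k$, so $\mathbb{R}^n=\mathbb{R}^{n-k}\times\mathbb{R}^k$; via these identifications $\mu_{n-k}$ acts on subsets of $H$, and $\mu_k$ and $\mathcal{C}_t(\phi_k)$ live in $H^\perp$. For $x\in P_HK$, $K(x)=(K-x)\cap H^\perp$. Densities are Lebesgue measurable. A function $\phi:\mathbb{R}^m\to[0,\infty)$ is quasi-concave if $\phi((1-\lambda)x+\lambda y)\ge\min\{\phi(x),\phi(y)\}$ for all $x,y$ and $\lambda\in(0,1)$; it is radially decreasing if $\phi(tx)\ge\phi(x)$ for all $t\in[0,1]$ and all $x$. $\|\phi\|_\infty$ is the essential supremum of $\phi$, $\mathrm{supp}\,\phi$ is the closure of $\{x:\phi(x)>0\}$, and $\mathcal{C}_t(\phi)=\{x\in\mathrm{supp}\,\phi:\phi(x)\ge t\|\phi\|_\infty\}$. $\mathrm{vol}_k$ is $k$-dimensional Lebesgue measure. *)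

theory Defs
  imports "HOL-Analysis.Analysis" "HOL-Probability.Essential_Supremum"
begin

definition convex_body :: "'a::euclidean_space set \<Rightarrow> bool" where
  "convex_body K \<longleftrightarrow> compact K \<and> convex K \<and> interior K \<noteq> {}"

(* For a subspace H the described point exists and is unique. *)
definition orth_proj :: "'a::euclidean_space set \<Rightarrow> 'a \<Rightarrow> 'a" where
  "orth_proj H x = (THE y. y \<in> H \<and> x - y \<in> H\<^sup>\<bottom>)"

definition perp_section :: "'a::euclidean_space set \<Rightarrow> 'a set \<Rightarrow> 'a \<Rightarrow> 'a set" where
  "perp_section H K x = {z - x | z. z \<in> K} \<inter> H\<^sup>\<bottom>"

definition quasi_concave :: "('a::real_vector \<Rightarrow> real) \<Rightarrow> bool" where
  "quasi_concave \<phi> \<longleftrightarrow>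
     (\<forall>x y. \<forall>u\<in>{0<..<1}. \<phi> ((1 - u) *\<^sub>R x + u *\<^sub>R y) \<ge> min (\<phi> x) (\<phi> y))"

definition radially_decreasing :: "('a::real_vector \<Rightarrow> real) \<Rightarrow> bool" where
  "radially_decreasing \<phi> \<longleftrightarrow> (\<forall>x. \<forall>t\<in>{0..1}. \<phi> (t *\<^sub>R x) \<ge> \<phi> x)"

(* Only used for nonnegative functions, so no absolute value is taken. *)
definition ess_norm :: "('a::euclidean_space \<Rightarrow> real) \<Rightarrow> ereal" where
  "ess_norm \<phi> = esssup lebesgue (\<lambda>x. ereal (\<phi> x))"

definition supp :: "('a::euclidean_space \<Rightarrow> real) \<Rightarrow> 'a set" where
  "supp \<phi> = closure {x. \<phi> x > 0}"

definition superlevel :: "real \<Rightarrow> ('a::euclidean_space \<Rightarrow> real) \<Rightarrow> 'a set" where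
  "superlevel t \<phi> = {x \<in> supp \<phi>. ereal (\<phi> x) \<ge> ereal t * ess_norm \<phi>}"

definition weighted_measure :: "('a::euclidean_space \<Rightarrow> real) \<Rightarrow> 'a measure" where
  "weighted_measure \<phi> = density lebesgue (\<lambda>x. ennreal (\<phi> x))"

(* Orthonormal coordinates on the subspace H: a linear isometry from the coordinate space
   onto H. Subsets of H are transported to the coordinate space by taking preimages. *)
definition orthonormal_coords ::
    "('c::euclidean_space \<Rightarrow> 'a::euclidean_space) \<Rightarrow> 'a set \<Rightarrow> bool" where
  "orthonormal_coords U H \<longleftrightarrow> linear U \<and> (\<forall>x. norm (U x) = norm x) \<and> range U = H"

end

theory Submission
  imports Defs
begin

text \<open>
  In the coordinates given by \<open>U\<close> and \<open>V\<close> the body becomes a compact convex set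
  \<open>M\<close> in a product space, the projection becomes \<open>L = {x. (x, 0) \<in> M}\<close>
  (projecting into the body means that the projection is the section by \<open>H\<close>), and the two
  remaining measures are those of \<open>M\<close> and of the section \<open>M\<^sub>0\<close> over the origin,
  where \<open>M\<^sub>x\<close> denotes the section over \<open>x\<close>. Write \<open>m\<close> and
  \<open>k\<close> for the dimensions of the two factors.

  For \<open>x \<in> L\<close> and \<open>s\<close> in the unit interval, convexity makes the section over
  \<open>s x\<close> contain \<open>(1 - s) M\<^sub>0\<close>. A quasi-concave density whose essential supremum is its
  value at the origin is, at almost every point, at most its value at any point nearer the origin
  on the same ray, so this inclusion already gives
  \<open>\<mu>\<^sub>k(M\<^sub>s\<^sub>x) \<ge> (1 - s)\<^sup>k \<mu>\<^sub>k(M\<^sub>0)\<close>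
  (\<open>measure_section_ge_power\<close>). Hence \<open>\<mu>\<^sub>k(M\<^sub>x) \<ge> (1 - r(x))\<^sup>k \<mu>\<^sub>k(M\<^sub>0)\<close>,
  where \<open>r(x)\<close> is the least \<open>s\<close> with \<open>x \<in> s L\<close>.

  It remains to integrate this over \<open>L\<close> against \<open>\<mu>\<^sub>m\<close>. Instead of polar
  coordinates, \<open>(1 - r(x))\<^sup>k\<close> is written as the integral of \<open>k (1 - s)\<^sup>k\<^sup>-\<^sup>1\<close> over
  those \<open>s\<close> with \<open>x \<in> s L\<close>. Tonelli's theorem then turns the integral over \<open>L\<close> into
  that of \<open>k (1 - s)\<^sup>k\<^sup>-\<^sup>1 \<mu>\<^sub>m(s L)\<close> over the unit interval; radial decrease gives
  \<open>\<mu>\<^sub>m(s L) \<ge> s\<^sup>m \<mu>\<^sub>m(L)\<close> (\<open>weighted_measure_dilation\<close>), and what is left is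
  a Beta integral equal to the reciprocal of the binomial coefficient
  (\<open>nn_integral_Beta_binomial\<close>).
\<close>

section \<open>Lebesgue measure: sigma-finiteness and dilations\<close>

lemma sigma_finite_lebesgue: "sigma_finite_measure (lebesgue :: 'a::euclidean_space measure)"
proof
  show "\<exists>A. countable A \<and> A \<subseteq> sets (lebesgue :: 'a measure) \<and> \<Union> A = space lebesgue
      \<and> (\<forall>a\<in>A. emeasure lebesgue a \<noteq> \<infinity>)"
  proof (intro exI conjI)
    show "(\<Union>n::nat. ball (0::'a) (real n)) = space lebesgue"
      using reals_Archimedean2 by auto
    show "\<forall>a\<in>range (\<lambda>n::nat. ball (0::'a) (real n)). emeasure lebesgue a \<noteq> \<infinity>"
      using emeasure_lborel_ball_finite[of "0::'a"] by (auto simp: less_top[symmetric])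
  qed auto
qed

lemma sigma_finite_weighted_measure:
  fixes g :: "'a::euclidean_space \<Rightarrow> real"
  assumes "g \<in> borel_measurable lebesgue"
  shows "sigma_finite_measure (weighted_measure g)"
  unfolding weighted_measure_def
  using sigma_finite_measure.sigma_finite_iff_density_finite[OF sigma_finite_lebesgue,
      of "\<lambda>x. ennreal (g x)"] assms by simp

lemma sets_weighted_measure [simp]: "sets (weighted_measure g) = sets lebesgue"
  by (simp add: weighted_measure_def)

text \<open>
  Used for compact subsets of a product of completed measures: such a product is not itself the
  completed measure of the product space, so Borel sets have to be reached through rectangles.
\<close>
lemma sets_borel_subset_pair_measure:
  assumes "sets borel \<subseteq> sets A" "sets borel \<subseteq> sets B" "space A = UNIV" "space B = UNIV"
  shows "sets (borel :: ('a::euclidean_space \<times> 'b::euclidean_space) measure) \<subseteq> sets (A \<Otimes>\<^sub>M B)"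
proof
  fix X :: "('a \<times> 'b) set" assume X: "X \<in> sets borel"
  have "(\<lambda>x. x) \<in> A \<rightarrow>\<^sub>M borel" "(\<lambda>x. x) \<in> B \<rightarrow>\<^sub>M borel"
    using assms by (auto simp: measurable_def)
  then have "(\<lambda>p. (fst p, snd p)) \<in> A \<Otimes>\<^sub>M B \<rightarrow>\<^sub>M borel \<Otimes>\<^sub>M borel"
    by (intro measurable_Pair measurable_compose[OF measurable_fst] measurable_compose[OF measurable_snd])
  then have "(\<lambda>p. p) \<in> A \<Otimes>\<^sub>M B \<rightarrow>\<^sub>M (borel :: ('a \<times> 'b) measure)"
    by (simp add: borel_prod)
  from measurable_sets[OF this X] show "X \<in> sets (A \<Otimes>\<^sub>M B)"
    using assms by (simp add: space_pair_measure)
qed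

lemma nn_integral_lebesgue_scaleR:
  fixes h :: "'a::euclidean_space \<Rightarrow> ennreal"
  assumes h: "h \<in> borel_measurable lebesgue" and s: "s > 0"
  shows "(\<integral>\<^sup>+x. h x \<partial>lebesgue) = ennreal (s ^ DIM('a)) * (\<integral>\<^sup>+x. h (s *\<^sub>R x) \<partial>lebesgue)"
proof -
  have T: "(\<lambda>x::'a. 0 + (\<Sum>j\<in>Basis. (s * (x \<bullet> j)) *\<^sub>R j)) = (*\<^sub>R) s"
    unfolding scaleR_scaleR[symmetric] scaleR_sum_right[symmetric] euclidean_representation by auto
  have leb: "(lebesgue :: 'a measure)
      = density (distr lebesgue lebesgue ((*\<^sub>R) s)) (\<lambda>_. ennreal (s ^ DIM('a)))"
    using lebesgue_affine_euclidean[of "\<lambda>_. s" "0::'a"] s unfolding T by (simp add: prod_constant)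
  have "(\<integral>\<^sup>+x. h x \<partial>lebesgue)
      = (\<integral>\<^sup>+x. h x \<partial>density (distr lebesgue lebesgue ((*\<^sub>R) s)) (\<lambda>_. ennreal (s ^ DIM('a))))"
    by (subst leb) (rule refl)
  also have "\<dots> = ennreal (s ^ DIM('a)) * (\<integral>\<^sup>+x. h x \<partial>distr lebesgue lebesgue ((*\<^sub>R) s))"
    using h by (subst nn_integral_density) (auto simp: nn_integral_cmult)
  also have "(\<integral>\<^sup>+x. h x \<partial>distr lebesgue lebesgue ((*\<^sub>R) s)) = (\<integral>\<^sup>+x. h (s *\<^sub>R x) \<partial>lebesgue)"
    using h by (subst nn_integral_distr) auto
  finally show ?thesis .
qed

text \<open>
  Substituting \<open>s x\<close> for \<open>x\<close> contributes the factor \<open>s\<close> to the power of the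
  dimension, and the density can only grow. Monotonicity along rays is required almost everywhere
  so that the lemma also serves densities controlled only by their essential supremum.
\<close>
lemma weighted_measure_dilation:
  fixes f :: "'a::euclidean_space \<Rightarrow> real"
  assumes f [measurable]: "f \<in> borel_measurable lebesgue"
    and A [measurable]: "A \<in> sets lebesgue" and B [measurable]: "B \<in> sets lebesgue"
    and s: "s \<ge> 0" and decr: "AE x in lebesgue. f x \<le> f (s *\<^sub>R x)"
    and AB: "\<And>x. x \<in> A \<Longrightarrow> s *\<^sub>R x \<in> B"
  shows "ennreal (s ^ DIM('a)) * emeasure (weighted_measure f) A \<le> emeasure (weighted_measure f) B"
proof (cases "s = 0")
  case False
  with s have s: "s > 0" by simp
  have "emeasure (weighted_measure f) A = (\<integral>\<^sup>+x. ennreal (f x) * indicator A x \<partial>lebesgue)"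
    by (simp add: weighted_measure_def emeasure_density)
  also have "\<dots> \<le> (\<integral>\<^sup>+x. ennreal (f (s *\<^sub>R x)) * indicator B (s *\<^sub>R x) \<partial>lebesgue)"
    using decr by (intro nn_integral_mono_AE, eventually_elim)
      (auto intro: ennreal_leI simp: indicator_def AB)
  finally have "ennreal (s ^ DIM('a)) * emeasure (weighted_measure f) A
      \<le> ennreal (s ^ DIM('a)) * (\<integral>\<^sup>+x. ennreal (f (s *\<^sub>R x)) * indicator B (s *\<^sub>R x) \<partial>lebesgue)"
    by (rule mult_left_mono) simp
  also have "\<dots> = (\<integral>\<^sup>+x. ennreal (f x) * indicator B x \<partial>lebesgue)"
    using s by (intro nn_integral_lebesgue_scaleR[symmetric]) auto
  also have "\<dots> = emeasure (weighted_measure f) B"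
    by (simp add: weighted_measure_def emeasure_density)
  finally show ?thesis .
qed (simp add: zero_power)

section \<open>Two one-dimensional integrals\<close>

lemma nn_integral_one_minus_power_le:
  fixes S :: "real set"
  assumes k: "k > 0" and r: "r \<le> 1" and S: "S \<subseteq> {r..1}"
  shows "(\<integral>\<^sup>+s. ennreal (real k * (1 - s) ^ (k - 1)) * indicator S s \<partial>lborel) \<le> ennreal ((1 - r) ^ k)"
proof -
  have "(\<integral>\<^sup>+s. ennreal (real k * (1 - s) ^ (k - 1)) * indicator S s \<partial>lborel)
      \<le> (\<integral>\<^sup>+s. ennreal (real k * (1 - s) ^ (k - 1)) * indicator {r..1} s \<partial>lborel)"
    using S by (intro nn_integral_mono mult_left_mono) (auto simp: indicator_def)
  also have "\<dots> = ennreal (- ((1 - 1) ^ k) - (- ((1 - r) ^ k)))"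
    using r by (intro nn_integral_FTC_Icc) (auto intro!: derivative_eq_intros)
  finally show ?thesis using k by (simp add: zero_power)
qed

text \<open>
  This integral is \<open>k\<close> times the Beta function at \<open>m + 1\<close> and \<open>k\<close>; it is the source of
  the binomial coefficient in the final inequality.
\<close>
lemma nn_integral_Beta_binomial:
  assumes k: "k > 0"
  shows "of_nat ((m + k) choose k) *
    (\<integral>\<^sup>+s. ennreal (real k * (1 - s) ^ (k - 1) * s ^ m) * indicator {0..1::real} s \<partial>lborel) = 1"
proof -
  have Gamma_nat: "Gamma (real (Suc n)) = fact n" for n
    using Gamma_fact[of n, where 'a = real] by simp
  have "((\<lambda>t. t powr (real (Suc m) - 1) * (1 - t) powr (real k - 1)) has_integral
      Beta (real (Suc m)) (real k)) {0..1}"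
    using k by (intro has_integral_Beta_real) auto
  moreover have "Beta (real (Suc m)) (real k) = fact m * fact (k - 1) / fact (m + k)"
    using Gamma_nat[of m] Gamma_nat[of "k - 1"] Gamma_nat[of "m + k"] k
    by (simp add: Beta_def add_ac)
  ultimately have "((\<lambda>t. real k * (t powr (real (Suc m) - 1) * (1 - t) powr (real k - 1))) has_integral
      real k * (fact m * fact (k - 1) / fact (m + k))) {0..1}"
    by (intro has_integral_mult_right) simp
  moreover have "real k * (fact m * fact (k - 1) / fact (m + k)) = 1 / real ((m + k) choose k)"
    using k by (simp add: binomial_fact fact_reduce[of k] field_simps)
  ultimately have I: "((\<lambda>t. real k * (t powr (real (Suc m) - 1) * (1 - t) powr (real k - 1))) has_integral
      1 / real ((m + k) choose k)) {0..1}" by simp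
  have "(1 - x) powr (real k - 1) = (1 - x) ^ (k - 1)" if "x < 1" for x :: real
    using that k powr_realpow[of "1 - x" "k - 1"] by (simp add: of_nat_diff)
  note powr_nat = this
  have "((\<lambda>s. real k * (1 - s) ^ (k - 1) * s ^ m) has_integral 1 / real ((m + k) choose k)) {0..1}"
    \<comment> \<open>The real powers vanish at base zero even for exponent zero, so the integrands may differ at
      the two endpoints.\<close>
    by (rule has_integral_spike[OF _ _ I, of "{0, 1}"])
      (auto simp: powr_realpow powr_nat)
  then have "(\<integral>\<^sup>+s. ennreal (real k * (1 - s) ^ (k - 1) * s ^ m) * indicator {0..1} s \<partial>lborel)
      = ennreal (1 / real ((m + k) choose k))"
    by (intro nn_integral_has_integral_lebesgue') auto
  then show ?thesis
    by (simp add: ennreal_of_nat_eq_real_of_nat flip: ennreal_mult)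
qed

section \<open>The inequality for convex bodies in a product space\<close>

text \<open>
  The segments joining points of the section over the origin to \<open>(x, 0)\<close> lie in \<open>M\<close>;
  they cut the section over \<open>r x\<close> in a copy of the section over the origin, shrunk by the
  factor \<open>1 - r\<close>.
\<close>
lemma measure_section_ge_power:
  fixes M :: "('a::euclidean_space \<times> 'b::euclidean_space) set"
  assumes M: "compact M" "convex M"
    and g: "g \<in> borel_measurable lebesgue"
    and decr: "\<And>t. t \<in> {0..1} \<Longrightarrow> AE y in lebesgue. g y \<le> g (t *\<^sub>R y)"
    and r: "r \<in> {0..1}" and x: "(x, 0) \<in> M"
  shows "ennreal ((1 - r) ^ DIM('b)) * emeasure (weighted_measure g) (Pair 0 -` M)
     \<le> emeasure (weighted_measure g) (Pair (r *\<^sub>R x) -` M)"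
proof (rule weighted_measure_dilation[OF g])
  have "closed (Pair z -` M)" for z :: 'a
    using M by (intro continuous_closed_vimage compact_imp_closed) (auto intro!: continuous_intros)
  then show "Pair 0 -` M \<in> sets lebesgue" "Pair (r *\<^sub>R x) -` M \<in> sets lebesgue"
    by (auto intro: borel_closed)
  show "AE y in lebesgue. g y \<le> g ((1 - r) *\<^sub>R y)"
    using r by (intro decr) auto
  show "(1 - r) *\<^sub>R y \<in> Pair (r *\<^sub>R x) -` M" if "y \<in> Pair 0 -` M" for y
    using convexD[OF M(2), of "(0, y)" "(x, 0)" "1 - r" r] that x r by auto
qed (use r in auto)

text \<open>
  Equality holds, for constant densities, when \<open>M\<close> is the convex hull of a body in the first
  factor and a body in the second, both containing the origin: then the section over \<open>x\<close> is
  exactly \<open>1 - r(x)\<close> times the section over the origin, with \<open>r\<close> the gauge of the first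
  body.
\<close>
theorem rogers_shephard_product:
  fixes M :: "('a::euclidean_space \<times> 'b::euclidean_space) set"
  assumes M: "compact M" "convex M" "(0, 0) \<in> M"
    and f [measurable]: "f \<in> borel_measurable lebesgue"
    and f_decr: "\<And>t. t \<in> {0..1} \<Longrightarrow> AE x in lebesgue. f x \<le> f (t *\<^sub>R x)"
    and g: "g \<in> borel_measurable lebesgue"
    and g_decr: "\<And>t. t \<in> {0..1} \<Longrightarrow> AE y in lebesgue. g y \<le> g (t *\<^sub>R y)"
  shows "emeasure (weighted_measure f) {x. (x, 0) \<in> M} * emeasure (weighted_measure g) {y. (0, y) \<in> M}
    \<le> of_nat ((DIM('a) + DIM('b)) choose DIM('b)) * emeasure (weighted_measure f \<Otimes>\<^sub>M weighted_measure g) M"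
proof -
  define k where "k = DIM('b)"
  define m where "m = DIM('a)"
  have k: "k > 0" by (simp add: k_def)
  define L where "L = {x. (x, 0) \<in> M}"
  define G where "G x = emeasure (weighted_measure g) (Pair x -` M)" for x
  define T where "T = (\<lambda>(s, x). (s, s *\<^sub>R x)) ` ({0..1::real} \<times> L)"
  define w where "w s = real k * (1 - s) ^ (k - 1)" for s :: real
  interpret g: sigma_finite_measure "weighted_measure g"
    by (rule sigma_finite_weighted_measure[OF g])
  interpret leb: sigma_finite_measure "lebesgue :: 'a measure"
    by (rule sigma_finite_lebesgue)
  interpret P: pair_sigma_finite "lborel :: real measure" "lebesgue :: 'a measure"
    ..
  have L: "compact L"
  proof -
    have "L = fst ` (M \<inter> UNIV \<times> {0})" by (force simp: L_def)
    moreover have "compact (M \<inter> UNIV \<times> {0})"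
      using M by (intro compact_Int_closed closed_Times) auto
    ultimately show ?thesis
      by (auto intro!: compact_continuous_image continuous_intros)
  qed
  have T: "compact T"
    unfolding T_def using L
    by (intro compact_continuous_image compact_Times)
      (auto simp: case_prod_unfold intro!: continuous_intros)
  have T_iff: "(s, x) \<in> T \<longleftrightarrow> s \<in> {0..1} \<and> (\<exists>z\<in>L. x = s *\<^sub>R z)" for s x
    by (auto simp: T_def)
  have T_sets [measurable]: "T \<in> sets (lborel \<Otimes>\<^sub>M (lebesgue :: 'a measure))"
    using T by (intro subsetD[OF sets_borel_subset_pair_measure]) (auto intro: borel_compact)
  have M_sets: "M \<in> sets (weighted_measure f \<Otimes>\<^sub>M weighted_measure g)"
    using M by (intro subsetD[OF sets_borel_subset_pair_measure]) (auto simp: weighted_measure_def intro: borel_compact)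
  \<comment> \<open>If some dilate \<open>s L\<close> contains \<open>x\<close>, then by compactness of \<open>T\<close> there is a
    least one; this least \<open>s\<close> is the gauge of \<open>x\<close>, and it exists even when
    the origin is not interior to \<open>L\<close>.\<close>
  have sect: "(\<integral>\<^sup>+s. ennreal (w s) * indicator T (s, x) \<partial>lborel) * G 0 \<le> G x" for x
  proof -
    define S where "S = (\<lambda>s. (s, x)) -` T"
    have ind: "indicator T (s, x) = (indicator S s :: ennreal)" for s
      by (auto simp: S_def indicator_def)
    show ?thesis
    proof (cases "S = {}")
      case True
      then show ?thesis by (simp add: ind)
    next
      case False
      have S01: "S \<subseteq> {0..1}"
        by (auto simp: S_def T_iff)
      then have bdd: "bdd_below S" by (rule bdd_below_mono[rotated]) simp
      have "closed S"
        unfolding S_def using T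
        by (intro continuous_closed_vimage compact_imp_closed) (auto intro!: continuous_intros)
      then have Inf: "Inf S \<in> S"
        using False bdd by (intro closed_contains_Inf) auto
      then obtain z where z: "z \<in> L" "x = Inf S *\<^sub>R z"
        by (auto simp: S_def T_iff)
      have "(\<integral>\<^sup>+s. ennreal (w s) * indicator S s \<partial>lborel) \<le> ennreal ((1 - Inf S) ^ k)"
        unfolding w_def
      proof (rule nn_integral_one_minus_power_le[OF k])
        show "Inf S \<le> 1" "S \<subseteq> {Inf S..1}"
          using S01 Inf cInf_lower[OF _ bdd] by (auto simp: subset_iff)
      qed
      then have "(\<integral>\<^sup>+s. ennreal (w s) * indicator S s \<partial>lborel) * G 0 \<le> ennreal ((1 - Inf S) ^ k) * G 0"
        by (rule mult_right_mono) simp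
      also have "\<dots> \<le> G x"
        unfolding G_def k_def z(2) using M g g_decr Inf S01 z(1)
        by (intro measure_section_ge_power) (auto simp: L_def)
      finally show ?thesis by (simp add: ind)
    qed
  qed
  have dil: "ennreal (s ^ m) * emeasure (weighted_measure f) L
      \<le> (\<integral>\<^sup>+x. ennreal (f x) * indicator T (s, x) \<partial>lebesgue)" if "s \<in> {0..1}" for s
  proof -
    have L_sets: "L \<in> sets lebesgue"
      using borel_compact[OF L] by simp
    have B [measurable]: "Pair s -` T \<in> sets lebesgue"
      using sets_Pair1[OF T_sets] by simp
    have "ennreal (s ^ m) * emeasure (weighted_measure f) L
        \<le> emeasure (weighted_measure f) (Pair s -` T)"
      unfolding m_def using that f_decr[of s]
      by (intro weighted_measure_dilation[OF f L_sets B]) (auto simp: T_iff)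
    also have "\<dots> = (\<integral>\<^sup>+x. ennreal (f x) * indicator (Pair s -` T) x \<partial>lebesgue)"
      by (simp add: weighted_measure_def emeasure_density)
    finally show ?thesis by (simp add: indicator_def)
  qed
  have [measurable]: "w \<in> borel_measurable borel"
    unfolding w_def by measurable
  have "emeasure (weighted_measure f) L * G 0
    = of_nat ((m + k) choose k) *
      (\<integral>\<^sup>+s. ennreal (w s * s ^ m) * indicator {0..1} s \<partial>lborel)
       * (emeasure (weighted_measure f) L * G 0)"
    unfolding w_def nn_integral_Beta_binomial[OF k] by simp
  also have "\<dots> = of_nat ((m + k) choose k) * ((\<integral>\<^sup>+s. ennreal (w s) * indicator {0..1} s *
       (ennreal (s ^ m) * emeasure (weighted_measure f) L) \<partial>lborel) * G 0)"
  proof -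
    have "(\<integral>\<^sup>+s. ennreal (w s * s ^ m) * indicator {0..1} s \<partial>lborel) * emeasure (weighted_measure f) L
      = (\<integral>\<^sup>+s. ennreal (w s * s ^ m) * indicator {0..1} s * emeasure (weighted_measure f) L \<partial>lborel)"
      by (subst nn_integral_multc) auto
    also have "\<dots> = (\<integral>\<^sup>+s. ennreal (w s) * indicator {0..1} s *
       (ennreal (s ^ m) * emeasure (weighted_measure f) L) \<partial>lborel)"
      by (intro nn_integral_cong)
        (auto simp: indicator_def w_def ennreal_mult' mult.assoc)
    finally show ?thesis by (simp add: mult.assoc flip: mult.assoc[of _ "emeasure _ _" "G 0"])
  qed
  also have "\<dots> \<le> of_nat ((m + k) choose k) * ((\<integral>\<^sup>+s. ennreal (w s) *
       (\<integral>\<^sup>+x. ennreal (f x) * indicator T (s, x) \<partial>lebesgue) \<partial>lborel) * G 0)"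
    using dil by (intro mult_left_mono mult_right_mono nn_integral_mono)
      (auto simp: indicator_def intro!: mult_left_mono)
  also have "(\<integral>\<^sup>+s. ennreal (w s) *
       (\<integral>\<^sup>+x. ennreal (f x) * indicator T (s, x) \<partial>lebesgue) \<partial>lborel)
     = (\<integral>\<^sup>+s. (\<integral>\<^sup>+x. ennreal (w s) * (ennreal (f x) * indicator T (s, x)) \<partial>lebesgue) \<partial>lborel)"
    by (intro nn_integral_cong nn_integral_cmult[symmetric]) measurable
  also have "\<dots> = (\<integral>\<^sup>+x. (\<integral>\<^sup>+s. ennreal (w s) * (ennreal (f x) * indicator T (s, x)) \<partial>lborel) \<partial>lebesgue)"
    by (intro P.Fubini'[symmetric]) measurable
  also have "\<dots> = (\<integral>\<^sup>+x. ennreal (f x) * (\<integral>\<^sup>+s. ennreal (w s) * indicator T (s, x) \<partial>lborel) \<partial>lebesgue)"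
    by (intro nn_integral_cong, subst nn_integral_cmult[symmetric]) (measurable, simp add: ac_simps)
  also have "\<dots> * G 0 = (\<integral>\<^sup>+x. ennreal (f x) * (\<integral>\<^sup>+s. ennreal (w s) * indicator T (s, x) \<partial>lborel) * G 0 \<partial>lebesgue)"
    by (intro nn_integral_multc[symmetric]) measurable
  also have "\<dots> \<le> (\<integral>\<^sup>+x. ennreal (f x) * G x \<partial>lebesgue)"
    unfolding mult.assoc by (intro nn_integral_mono mult_left_mono sect) auto
  also have "\<dots> = (\<integral>\<^sup>+x. G x \<partial>weighted_measure f)"
  proof -
    have "G \<in> borel_measurable (weighted_measure f)"
      unfolding G_def by (rule g.measurable_emeasure_Pair[OF M_sets])
    then show ?thesis
      by (simp add: weighted_measure_def nn_integral_density)
  qed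
  also have "\<dots> = emeasure (weighted_measure f \<Otimes>\<^sub>M weighted_measure g) M"
    unfolding G_def by (rule g.emeasure_pair_measure_alt[OF M_sets, symmetric])
  finally show ?thesis
    by (simp add: mult_left_mono G_def L_def k_def m_def vimage_def)
qed

section \<open>Sections and projections of a convex body\<close>

lemma orth_proj_ident:
  assumes H: "subspace H" and x: "x \<in> H"
  shows "orth_proj H x = x"
  unfolding orth_proj_def
proof (rule the_equality)
  fix y assume y: "y \<in> H \<and> x - y \<in> H\<^sup>\<bottom>"
  then have "x - y \<in> H" using H x by (auto intro: subspace_diff)
  then have "orthogonal (x - y) (x - y)" using y by (auto simp: orthogonal_comp_def)
  then show "y = x" by (simp add: orthogonal_self)
qed (use x in \<open>auto simp: orthogonal_comp_def orthogonal_def\<close>)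

text \<open>
  Quasi-concavity on the segment from the origin to \<open>y\<close> bounds the density below by its smaller
  endpoint value, which is the one at \<open>y\<close> unless \<open>y\<close> lies in the null set where the
  essential supremum is exceeded.
\<close>
lemma quasi_concave_radially_decreasing_AE:
  fixes g :: "'a::euclidean_space \<Rightarrow> real"
  assumes g: "quasi_concave g" and max: "ess_norm g = ereal (g 0)" and t: "t \<in> {0..1}"
  shows "AE y in lebesgue. g y \<le> g (t *\<^sub>R y)"
proof -
  have "AE y in lebesgue. ereal (g y) \<le> ereal (g 0)"
    unfolding max[symmetric] ess_norm_def by (rule esssup_AE)
  then show ?thesis
  proof eventually_elim
    case (elim y)
    consider "t = 0" | "t = 1" | "t \<in> {0<..<1}" using t by fastforce
    then show ?case
    proof cases
      case 3
      then have "g ((1 - t) *\<^sub>R 0 + t *\<^sub>R y) \<ge> min (g 0) (g y)"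
        using g unfolding quasi_concave_def by blast
      with elim show ?thesis by simp
    qed (use elim in auto)
  qed
qed

theorem theorem1p3:
  fixes k :: nat
    and H :: "(real ^ 'n) set"
    and U :: "real ^ 'm \<Rightarrow> real ^ 'n"
    and V :: "real ^ 'k \<Rightarrow> real ^ 'n"
    and \<phi>m :: "real ^ 'm \<Rightarrow> real"
    and \<phi>k :: "real ^ 'k \<Rightarrow> real"
    and K :: "(real ^ 'n) set"
  assumes "k \<in> {1..CARD('n) - 1}"
    and "CARD('k) = k"
    and "CARD('m) = CARD('n) - k"
    and "subspace H"
    and "dim H = CARD('n) - k"
    and "orthonormal_coords U H"
    and "orthonormal_coords V (H\<^sup>\<bottom>)"
    and "\<phi>k \<in> borel_measurable lebesgue"
    and "\<And>y. \<phi>k y \<ge> 0"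
    and "quasi_concave \<phi>k"
    and "isCont \<phi>k 0"
    and "ess_norm \<phi>k = ereal (\<phi>k 0)"
    and "\<phi>m \<in> borel_measurable lebesgue"
    and "\<And>x. \<phi>m x \<ge> 0"
    and "radially_decreasing \<phi>m"
    and "convex_body K"
    and "orth_proj H ` K \<subseteq> K"
    and "\<And>t. t \<in> {0<..<1} \<Longrightarrow>
           0 \<in> orth_proj H ` K \<and>
           (\<forall>x \<in> orth_proj H ` K.
              emeasure lebesgue (superlevel t \<phi>k \<inter> V -` perp_section H K x)
            \<le> emeasure lebesgue (superlevel t \<phi>k \<inter> V -` perp_section H K 0))"
  shows "emeasure (weighted_measure \<phi>m) (U -` (orth_proj H ` K))
         * emeasure (weighted_measure \<phi>k) (V -` (K \<inter> H\<^sup>\<bottom>))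
       \<le> of_nat (CARD('n) choose k)
         * emeasure (weighted_measure \<phi>m \<Otimes>\<^sub>M weighted_measure \<phi>k)
             ((\<lambda>(x, y). U x + V y) -` K)"
proof -
  let ?M = "(\<lambda>(x, y). U x + V y) -` K"
  have U: "linear U" "\<And>x. norm (U x) = norm x" "range U = H"
    and V: "linear V" "\<And>x. norm (V x) = norm x" "range V = H\<^sup>\<bottom>"
    using assms(6,7) by (auto simp: orthonormal_coords_def)
  have UV: "linear (\<lambda>(x, y). U x + V y)"
    using U(1) V(1) by (auto simp: linear_iff algebra_simps)
  have K: "compact K" "convex K"
    using assms(16) by (auto simp: convex_body_def)
  have L: "U -` (orth_proj H ` K) = {x. (x, 0) \<in> ?M}"
  proof -
    have "U x \<in> orth_proj H ` K \<longleftrightarrow> U x \<in> K" for x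
      using assms(17) orth_proj_ident[OF assms(4), of "U x"] U(3) by (metis image_eqI rangeI subsetD)
    then show ?thesis using linear_0[OF V(1)] by auto
  qed
  have M0: "V -` (K \<inter> H\<^sup>\<bottom>) = {y. (0, y) \<in> ?M}"
    using linear_0[OF U(1)] V(3) by auto
  have "0 \<in> K"
    using assms(18)[of "1/2"] assms(17) by auto
  then have zero: "(0, 0) \<in> ?M"
    using linear_0[OF U(1)] linear_0[OF V(1)] by simp
  have "closed ?M"
    using K UV by (intro continuous_closed_vimage compact_imp_closed)
      (auto simp: linear_continuous_at linear_linear)
  moreover have "bounded ?M"
  proof -
    obtain B where B: "\<And>z. z \<in> K \<Longrightarrow> norm z \<le> B"
      using K(1) compact_imp_bounded bounded_iff by metis
    have "norm p \<le> B" if "p \<in> ?M" for p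
    proof (cases p)
      case (Pair x y)
      have "orthogonal (U x) (V y)"
        using U(3) V(3) by (auto simp: orthogonal_comp_def)
      then have "(norm (U x + V y))\<^sup>2 = (norm p)\<^sup>2"
        using U(2) V(2) Pair by (simp add: norm_prod_def norm_add_Pythagorean)
      then have "norm (U x + V y) = norm p"
        by simp
      then show ?thesis using B[of "U x + V y"] that Pair by auto
    qed
    then show ?thesis unfolding bounded_iff by blast
  qed
  ultimately have "compact ?M"
    by (simp add: compact_eq_bounded_closed)
  moreover have "convex ?M"
    using UV K(2) by (rule convex_linear_vimage)
  moreover have "AE x in lebesgue. \<phi>m x \<le> \<phi>m (t *\<^sub>R x)" if "t \<in> {0..1}" for t
    using assms(15) that by (auto simp: radially_decreasing_def)
  moreover have "AE y in lebesgue. \<phi>k y \<le> \<phi>k (t *\<^sub>R y)" if "t \<in> {0..1}" for t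
    using assms(10,12) that by (rule quasi_concave_radially_decreasing_AE)
  ultimately have "emeasure (weighted_measure \<phi>m) {x. (x, 0) \<in> ?M} * emeasure (weighted_measure \<phi>k) {y. (0, y) \<in> ?M}
    \<le> of_nat ((DIM(real ^ 'm) + DIM(real ^ 'k)) choose DIM(real ^ 'k)) *
      emeasure (weighted_measure \<phi>m \<Otimes>\<^sub>M weighted_measure \<phi>k) ?M"
    using zero assms(8,13) by (intro rogers_shephard_product)
  moreover have "DIM(real ^ 'm) + DIM(real ^ 'k) = CARD('n)" "DIM(real ^ 'k) = k"
    using assms(1-3) by auto
  ultimately show ?thesis
    unfolding L M0 by simp
qed

end
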